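(* Let $\mathbf{a}=(a_1,a_2,\ldots,a_k)\in\mathbb{Z}_{\geq 1}^k$ be a composition of $n$. Then the number of weakly flattened Fubini rankings with runs of weak ascents that have reduced content $\mathbf{a}$ and whose last entry has value $1$ is $$\prod_{i=2}^k\binom{a_1+a_i-2}{a_i}.$$
   Context: Let $[n]=\{1,2,\ldots,n\}$. A Fubini ranking of length $n$ is a tuple $r=(r_1,\ldots,r_n)\in[n]^n$ that records a valid ranking of $n$ competitors with ties allowed, where if exactly $k$ competitors are tied at rank $i$, then the next $k-1$ ranks $i+1,\ldots,i+k-1$ are disallowed; equivalently, $r_i=1+|\{j : r_j<r_i\}|$ for every $i\in[n]$. The content of a Fubini ranking of length $n$ is the tuple $(c_1,\ldots,c_n)$ where $c_i$ is the number of entries equal to $i$; the reduced content is obtained from the content by deleting all entries equal to $0$. A run of weak ascents of a word $w=w_1\cdots w_n$ is a maximal contiguous subword $w_iw_{i+1}\cdots w_j$ with $w_l\le w_{l+1}$ for all $i\le l\le j-1$. A Fubini ranking is weakly flattened with runs of weak ascents if the leading (first) terms of its runs of weak ascents, read from left to right, are in weakly increasing order. A composition of $n$ is a tuple of positive integers with sum $n$. *)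

theory Defs
  imports Main
begin

text \<open>Tuples are lists: positions \<open>1, \<dots>, n\<close> become the list indices \<open>0, \<dots>, n - 1\<close>, while
  the values (ranks) are \<open>1, \<dots>, n\<close> unchanged.\<close>

definition composition :: "nat \<Rightarrow> nat list \<Rightarrow> bool" where
  "composition n a \<longleftrightarrow> (\<forall>x\<in>set a. 1 \<le> x) \<and> sum_list a = n"

definition fubini_ranking :: "nat \<Rightarrow> nat list \<Rightarrow> bool" where
  "fubini_ranking n r \<longleftrightarrow>
     length r = n \<and> set r \<subseteq> {1..n} \<and>
     (\<forall>i<n. r ! i = 1 + card {j. j < n \<and> r ! j < r ! i})"

definition content :: "nat list \<Rightarrow> nat list" where
  "content r = map (count_list r) [1..<Suc (length r)]"

definition reduced_content :: "nat list \<Rightarrow> nat list" where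
  "reduced_content r = filter (\<lambda>c. c \<noteq> 0) (content r)"

definition weakly_ascending_between :: "nat list \<Rightarrow> nat \<Rightarrow> nat \<Rightarrow> bool" where
  "weakly_ascending_between w i j \<longleftrightarrow>
     i \<le> j \<and> j < length w \<and> (\<forall>l. i \<le> l \<and> l < j \<longrightarrow> w ! l \<le> w ! Suc l)"

text \<open>A run is represented by its first and last positions; maximality is with respect to
  inclusion of position intervals.\<close>

definition weak_ascent_run :: "nat list \<Rightarrow> nat \<Rightarrow> nat \<Rightarrow> bool" where
  "weak_ascent_run w i j \<longleftrightarrow>
     weakly_ascending_between w i j \<and>
     (\<forall>i' j'. i' \<le> i \<and> j \<le> j' \<and> weakly_ascending_between w i' j' \<longrightarrow> i' = i \<and> j' = j)"

definition run_leading_terms :: "nat list \<Rightarrow> nat list" where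
  "run_leading_terms w =
     map (\<lambda>i. w ! i) (filter (\<lambda>i. \<exists>j. weak_ascent_run w i j) [0..<length w])"

definition weakly_flattened :: "nat list \<Rightarrow> bool" where
  "weakly_flattened w \<longleftrightarrow> sorted (run_leading_terms w)"

end

theory Submission
  imports Defs "HOL-Library.Multiset" "HOL-Library.FuncSet"
begin

text \<open>
  A word whose last entry is its minimum \<open>1\<close> has a final run of weak ascents consisting of ones
  only, since that run climbs weakly to \<open>1\<close>. If the leading terms of the runs increase weakly, all of
  them are therefore at most \<open>1\<close>: the word starts with \<open>1\<close> and every descent lands on a \<open>1\<close>.
  Conversely, such a word is weakly flattened, because all leading terms are equal to \<open>1\<close>
  (\<open>weakly_flattened_ending_in_min_iff\<close>). It therefore has the shape \<open>1 B\<^sub>1 1 B\<^sub>2 \<dots> 1 B\<^sub>s 1\<close>, where each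
  block \<open>B\<^sub>j\<close> is a weakly increasing word without ones, that is, a multiset written in sorted order.

  With \<open>a\<^sub>1\<close> ones there are \<open>s = a\<^sub>1 - 1\<close> blocks, and the word amounts to a distribution of the
  remaining entries over these blocks. Different values are distributed independently, and \<open>c\<close>
  equal entries can be distributed over \<open>s\<close> blocks in \<open>(c + s - 1) choose c\<close> ways
  (\<open>card_mset_blocks\<close>, \<open>card_words_descending_only_to_min\<close>).

  Finally, the reduced content of a Fubini ranking determines its multiset of entries: the \<open>i\<close>-th
  smallest rank is \<open>1\<close> plus the number of competitors with a smaller rank, that is,
  \<open>1 + a\<^sub>1 + \<dots> + a\<^bsub>i-1\<^esub>\<close>. Every arrangement of that multiset is a Fubini ranking
  (\<open>fubini_ranking_with_reduced_content_iff\<close>). Hence the rank with multiplicity \<open>a\<^sub>i\<close> contributes the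
  factor \<open>(a\<^sub>1 + a\<^sub>i - 2) choose a\<^sub>i\<close> for each \<open>i \<ge> 2\<close>.
\<close>

section \<open>Distributing a multiset over numbered blocks\<close>

lemma count_sum_list_mset: "count (sum_list Bs) x = sum_list (map (\<lambda>B. count B x) Bs)"
  by (induction Bs) auto

text \<open>Recording, for every value \<open>x\<close> of \<open>M\<close>, the list of its multiplicities in the blocks turns a
  list of \<open>s\<close> blocks into an independent choice, for each \<open>x\<close>, of \<open>s\<close> naturals with sum
  \<open>count M x\<close>. If \<open>s = 0\<close>, truncated subtraction makes each factor \<open>(c - 1) choose c = 0\<close>, as it
  should be, since \<open>c > 0\<close> for the values of \<open>M\<close>.\<close>

lemma card_mset_blocks:
  "card {Bs. length Bs = s \<and> sum_list Bs = M} =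
     (\<Prod>x\<in>set_mset M. (count M x + s - 1) choose count M x)"
proof -
  let ?L = "{Bs. length Bs = s \<and> sum_list Bs = M}"
  let ?F = "\<Pi>\<^sub>E x\<in>set_mset M. {l::nat list. length l = s \<and> sum_list l = count M x}"
  let ?h = "\<lambda>Bs. \<lambda>x\<in>set_mset M. map (\<lambda>B. count B x) Bs"
  have sub: "set_mset B \<subseteq> set_mset M" if "Bs \<in> ?L" "B \<in> set Bs" for Bs B
    using that set_mset_sum_list[of Bs] by auto
  have "bij_betw ?h ?L ?F"
    unfolding bij_betw_def
  proof (intro conjI subset_antisym)
    show "inj_on ?h ?L"
    proof (rule inj_onI)
      fix Bs Cs assume B: "Bs \<in> ?L" and C: "Cs \<in> ?L" and eq: "?h Bs = ?h Cs"
      have "Bs ! i = Cs ! i" if i: "i < s" for i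
      proof (rule multiset_eqI)
        fix x
        have mem: "Bs ! i \<in> set Bs" "Cs ! i \<in> set Cs" using i B C by auto
        show "count (Bs ! i) x = count (Cs ! i) x"
        proof (cases "x \<in> set_mset M")
          case True
          then have "map (\<lambda>B. count B x) Bs = map (\<lambda>B. count B x) Cs"
            using fun_cong[OF eq, of x] by simp
          then have "map (\<lambda>B. count B x) Bs ! i = map (\<lambda>B. count B x) Cs ! i"
            by simp
          then show ?thesis using i B C by simp
        next
          case False
          then show ?thesis using sub[OF B mem(1)] sub[OF C mem(2)]
            by (metis in_mono not_in_iff)
        qed
      qed
      then show "Bs = Cs" using B C by (auto intro: nth_equalityI)
    qed
    show "?h ` ?L \<subseteq> ?F"
      by (auto simp: count_sum_list_mset[symmetric])
    show "?F \<subseteq> ?h ` ?L"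
    proof
      fix f assume f: "f \<in> ?F"
      \<comment> \<open>the \<open>i\<close>-th block receives \<open>f x ! i\<close> copies of \<open>x\<close>\<close>
      define Bs where
        "Bs = map (\<lambda>i. \<Sum>x\<in>set_mset M. replicate_mset (f x ! i) x) [0..<s]"
      have fx: "length (f x) = s" "sum_list (f x) = count M x" if "x \<in> set_mset M" for x
        using f that by auto
      have cnt: "map (\<lambda>B. count B x) Bs = (if x \<in> set_mset M then f x else replicate s 0)"
        for x
      proof -
        have "count (\<Sum>y\<in>set_mset M. replicate_mset (f y ! i) y) x
                = (if x \<in> set_mset M then f x ! i else 0)" for i
          by (simp add: count_sum count_replicate_mset sum.delta)
        then show ?thesis
          unfolding Bs_def by (auto intro!: nth_equalityI simp: fx)
      qed
      have "sum_list Bs = M"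
        by (rule multiset_eqI)
           (auto simp: count_sum_list_mset cnt fx sum_list_replicate not_in_iff)
      moreover have "length Bs = s" by (simp add: Bs_def)
      moreover have "?h Bs = f"
        using f by (auto simp: cnt fun_eq_iff PiE_def extensional_def)
      ultimately show "f \<in> ?h ` ?L" by blast
    qed
  qed
  then have "card ?L = card ?F" by (rule bij_betw_same_card)
  then show ?thesis by (simp add: card_PiE card_length_sum_list)
qed

section \<open>Words cut into blocks by a separator\<close>

definition separated_blocks :: "'a::linorder \<Rightarrow> 'a multiset list \<Rightarrow> 'a list" where
  "separated_blocks m Bs = concat (map (\<lambda>B. m # sorted_list_of_multiset B) Bs) @ [m]"

lemma separated_blocks_simps [simp]:
  "separated_blocks m [] = [m]"
  "separated_blocks m (B # Bs) = m # sorted_list_of_multiset B @ separated_blocks m Bs"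
  by (simp_all add: separated_blocks_def)

lemma separated_blocks_not_Nil [simp]: "separated_blocks m Bs \<noteq> []"
  by (simp add: separated_blocks_def)

lemma hd_separated_blocks [simp]: "hd (separated_blocks m Bs) = m"
  by (cases Bs) auto

lemma last_separated_blocks [simp]: "last (separated_blocks m Bs) = m"
  by (simp add: separated_blocks_def)

lemma mset_separated_blocks:
  "mset (separated_blocks m Bs) = replicate_mset (Suc (length Bs)) m + sum_list Bs"
  by (induction Bs) auto

definition descends_only_to :: "'a::linorder \<Rightarrow> 'a list \<Rightarrow> bool" where
  "descends_only_to m = successively (\<lambda>x y. x \<le> y \<or> y = m)"

lemma descends_only_to_if_sorted: "sorted w \<Longrightarrow> descends_only_to m w"
  unfolding descends_only_to_def
  by (rule successively_if_sorted_wrt) (rule sorted_wrt_mono_rel, auto)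

lemma sorted_if_descends_only_to:
  assumes "descends_only_to m w" "m \<notin> set w"
  shows "sorted w"
proof -
  have "successively (\<le>) w"
    using assms(1) unfolding descends_only_to_def
    by (rule successively_mono) (use assms(2) in auto)
  then show ?thesis
    by (simp add: successively_conv_sorted_wrt)
qed

text \<open>Inside a sorted piece \<open>m B\<close> there are no descents, and the next piece starts with \<open>m\<close>.\<close>

lemma descends_only_to_separated_blocks:
  assumes "\<And>B x. B \<in> set Bs \<Longrightarrow> x \<in># B \<Longrightarrow> m \<le> x"
  shows "descends_only_to m (separated_blocks m Bs)"
  using assms
proof (induction Bs)
  case Nil
  then show ?case by (simp add: descends_only_to_def)
next
  case (Cons B Bs)
  have "sorted (m # sorted_list_of_multiset B)" using Cons.prems by auto
  then have "descends_only_to m (m # sorted_list_of_multiset B)"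
    by (rule descends_only_to_if_sorted)
  moreover have "descends_only_to m (separated_blocks m Bs)" using Cons by auto
  ultimately have "descends_only_to m ((m # sorted_list_of_multiset B) @ separated_blocks m Bs)"
    unfolding descends_only_to_def by (subst successively_append_iff) auto
  then show ?case by simp
qed

text \<open>The first block can be read off the word as the part between its first two occurrences of \<open>m\<close>;
  for this the blocks themselves must not contain \<open>m\<close>.\<close>

lemma separated_blocks_inject:
  assumes "separated_blocks m Bs = separated_blocks m Cs"
    and "\<And>B. B \<in> set Bs \<Longrightarrow> m \<notin># B" and "\<And>C. C \<in> set Cs \<Longrightarrow> m \<notin># C"
  shows "Bs = Cs"
  using assms
proof (induction Bs arbitrary: Cs)
  case Nil
  then show ?case by (cases Cs) auto
next
  case (Cons B Bs)
  then obtain C Ds where Cs: "Cs = C # Ds" by (cases Cs) auto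
  let ?sl = sorted_list_of_multiset
  have cut: "takeWhile (\<lambda>x. x \<noteq> m) (?sl B @ separated_blocks m Bs) = ?sl B \<and>
             dropWhile (\<lambda>x. x \<noteq> m) (?sl B @ separated_blocks m Bs) = separated_blocks m Bs"
    if "m \<notin># B" for B and Bs :: "'a multiset list"
  proof -
    obtain w where "separated_blocks m Bs = m # w"
      by (metis hd_separated_blocks list.collapse separated_blocks_not_Nil)
    moreover have "\<And>x. x \<in> set (?sl B) \<Longrightarrow> x \<noteq> m" using that by auto
    ultimately show ?thesis by (simp add: takeWhile_append2 dropWhile_append2 del: set_sorted_list_of_multiset)
  qed
  have eq: "?sl B @ separated_blocks m Bs = ?sl C @ separated_blocks m Ds"
    using Cons.prems(1) Cs by simp
  have nB: "m \<notin># B" and nC: "m \<notin># C" using Cons.prems Cs by auto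
  have "?sl B = ?sl C" "separated_blocks m Bs = separated_blocks m Ds"
    using cut[OF nB, of Bs] cut[OF nC, of Ds] eq by metis+
  moreover have "B = C" using calculation(1) by (metis mset_sorted_list_of_multiset)
  ultimately show ?case using Cons.IH[of Ds] Cons.prems Cs by simp
qed

text \<open>Cutting the word before every occurrence of \<open>m\<close> leaves pieces without \<open>m\<close>, in which no
  descent is possible; so they are sorted and determined by their multisets.\<close>

lemma separated_blocks_surj:
  assumes "w \<noteq> []" "hd w = m" "last w = m" "descends_only_to m w"
  shows "\<exists>Bs. separated_blocks m Bs = w \<and> (\<forall>B\<in>set Bs. m \<notin># B)"
  using assms
proof (induction "length w" arbitrary: w rule: less_induct)
  case less
  obtain v where w: "w = m # v" using less.prems by (cases w) auto
  show ?case
  proof (cases "v = []")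
    case True
    then show ?thesis using w by (intro exI[of _ "[]"]) auto
  next
    case False
    define b where "b = takeWhile (\<lambda>x. x \<noteq> m) v"
    define u where "u = dropWhile (\<lambda>x. x \<noteq> m) v"
    have v: "v = b @ u" by (simp add: b_def u_def)
    have "m \<in> set v" using False less.prems(3) w by (metis last_ConsR last_in_set)
    then have u: "u \<noteq> []" unfolding u_def by simp
    then have hu: "hd u = m" unfolding u_def using hd_dropWhile by fast
    have desc: "descends_only_to m b" "descends_only_to m u"
      using less.prems(4) unfolding w v descends_only_to_def
      by (auto simp: successively_Cons successively_append_iff)
    have "m \<notin> set b" unfolding b_def by (auto dest: set_takeWhileD)
    then have "sorted b" by (rule sorted_if_descends_only_to[OF desc(1)])
    obtain Bs where Bs: "separated_blocks m Bs = u" "\<forall>B\<in>set Bs. m \<notin># B"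
      using less.hyps[of u] u hu desc(2) less.prems(3) w v by auto
    have "separated_blocks m (mset b # Bs) = w"
      using Bs(1) w v \<open>sorted b\<close> by (simp add: sorted_sort_id)
    then show ?thesis using Bs(2) \<open>m \<notin> set b\<close> by (intro exI[of _ "mset b # Bs"]) auto
  qed
qed

text \<open>The \<open>s + 1\<close> copies of the minimum \<open>m\<close> enclose \<open>s\<close> blocks that share out \<open>M\<close>.\<close>

lemma card_words_descending_only_to_min:
  fixes m :: "'a::linorder"
  assumes min: "\<And>x. x \<in># M \<Longrightarrow> m < x"
  shows "card {w. mset w = replicate_mset (Suc s) m + M \<and> hd w = m \<and> last w = m \<and>
                  descends_only_to m w} =
           (\<Prod>x\<in>set_mset M. (count M x + s - 1) choose count M x)"
    (is "card ?W = _")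
proof -
  let ?L = "{Bs. length Bs = s \<and> sum_list Bs = M}"
  have gt: "m < x" if "Bs \<in> ?L" "B \<in> set Bs" "x \<in># B" for Bs B x
    using that set_mset_sum_list[of Bs] by (intro min) auto
  have "bij_betw (separated_blocks m) ?L ?W"
    unfolding bij_betw_def
  proof (intro conjI subset_antisym)
    show "inj_on (separated_blocks m) ?L"
      by (rule inj_onI, rule separated_blocks_inject) (use gt in blast)+
    show "separated_blocks m ` ?L \<subseteq> ?W"
    proof (rule image_subsetI)
      fix Bs assume Bs: "Bs \<in> ?L"
      have "descends_only_to m (separated_blocks m Bs)"
        using gt[OF Bs] by (intro descends_only_to_separated_blocks) (simp add: less_imp_le)
      then show "separated_blocks m Bs \<in> ?W"
        using Bs by (simp add: mset_separated_blocks)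
    qed
    show "?W \<subseteq> separated_blocks m ` ?L"
    proof
      fix w assume w: "w \<in> ?W"
      then have "w \<noteq> []" by auto
      with w obtain Bs where Bs: "separated_blocks m Bs = w" "\<forall>B\<in>set Bs. m \<notin># B"
        using separated_blocks_surj[of w m] by auto
      have eq: "replicate_mset (Suc (length Bs)) m + sum_list Bs = replicate_mset (Suc s) m + M"
        using w Bs(1) mset_separated_blocks[of m Bs] by simp
      have "m \<notin># sum_list Bs" using Bs(2) by auto
      moreover have "m \<notin># M" using min by blast
      ultimately have "length Bs = s"
        using arg_cong[OF eq, of "\<lambda>A. count A m"]
        by (simp del: set_mset_sum_list add: count_eq_zero_iff[THEN iffD2])
      then have "Bs \<in> ?L" using eq by simp
      then show "w \<in> separated_blocks m ` ?L" using Bs(1) by blast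
    qed
  qed
  then have "card ?L = card ?W" by (rule bij_betw_same_card)
  then show ?thesis using card_mset_blocks[of s M] by simp
qed

section \<open>Weakly flattened words ending in their minimum\<close>

text \<open>A run can be extended to the left exactly when the step before its first position is not a
  descent; a longest weak ascent from a given position always exists.\<close>

lemma run_start_iff:
  "(\<exists>j. weak_ascent_run w i j) \<longleftrightarrow> i < length w \<and> (i = 0 \<or> w ! i < w ! (i - 1))"
proof
  assume "\<exists>j. weak_ascent_run w i j"
  then obtain j where j: "weakly_ascending_between w i j"
    and mx: "\<And>i' j'. i' \<le> i \<Longrightarrow> j \<le> j' \<Longrightarrow> weakly_ascending_between w i' j' \<Longrightarrow> i' = i \<and> j' = j"
    unfolding weak_ascent_run_def by blast
  have "w ! i < w ! (i - 1)" if "i \<noteq> 0"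
  proof (rule ccontr)
    assume "\<not> w ! i < w ! (i - 1)"
    then have le: "w ! (i - 1) \<le> w ! i" by simp
    have "w ! l \<le> w ! Suc l" if "i - 1 \<le> l" "l < j" for l
    proof (cases "l = i - 1")
      case True
      then show ?thesis using le \<open>i \<noteq> 0\<close> by simp
    next
      case False
      then show ?thesis using j that unfolding weakly_ascending_between_def by auto
    qed
    then have "weakly_ascending_between w (i - 1) j"
      using j unfolding weakly_ascending_between_def by auto
    then show False using mx[of "i - 1" j] \<open>i \<noteq> 0\<close> by simp
  qed
  then show "i < length w \<and> (i = 0 \<or> w ! i < w ! (i - 1))"
    using j unfolding weakly_ascending_between_def by auto
next
  assume i: "i < length w \<and> (i = 0 \<or> w ! i < w ! (i - 1))"
  let ?P = "weakly_ascending_between w i"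
  have "?P i" using i unfolding weakly_ascending_between_def by auto
  moreover have bnd: "\<And>j. ?P j \<Longrightarrow> j \<le> length w" unfolding weakly_ascending_between_def by auto
  ultimately have P: "?P (GREATEST j. ?P j)"
    by (rule GreatestI_nat)
  have G: "j \<le> (GREATEST j. ?P j)" if "?P j" for j
    using that bnd by (rule Greatest_le_nat)
  have "weak_ascent_run w i (GREATEST j. ?P j)"
    unfolding weak_ascent_run_def
  proof (intro conjI allI impI P)
    fix i' j'
    assume A: "i' \<le> i \<and> (GREATEST j. ?P j) \<le> j' \<and> weakly_ascending_between w i' j'"
    have ij: "i \<le> j'" using A P unfolding weakly_ascending_between_def by linarith
    show *: "i' = i"
    proof (rule ccontr)
      assume "i' \<noteq> i"
      then have "i' \<le> i - 1" "i - 1 < j'" "i \<noteq> 0" using A ij by auto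
      then have "w ! (i - 1) \<le> w ! i"
        using A unfolding weakly_ascending_between_def by (metis Suc_pred' neq0_conv)
      then show False using i \<open>i \<noteq> 0\<close> by simp
    qed
    then show "j' = (GREATEST j. ?P j)" using A G by (simp add: le_antisym)
  qed
  then show "\<exists>j. weak_ascent_run w i j" by blast
qed

lemma weakly_flattened_iff_run_starts:
  "weakly_flattened w \<longleftrightarrow>
     (\<forall>i j. i < j \<and> (\<exists>l. weak_ascent_run w i l) \<and> (\<exists>l. weak_ascent_run w j l) \<longrightarrow> w ! i \<le> w ! j)"
proof -
  define S where "S i \<longleftrightarrow> (\<exists>l. weak_ascent_run w i l)" for i
  have S: "S i \<Longrightarrow> i < length w" for i unfolding S_def run_start_iff by simp
  have "sorted (map (\<lambda>i. w ! i) (filter S [0..<length w])) \<longleftrightarrow>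
          (\<forall>i j. i < j \<and> S i \<and> S j \<longrightarrow> w ! i \<le> w ! j)"
  proof -
    have "sorted_wrt (\<lambda>i j. w ! i \<le> w ! j) (filter S [0..<n]) \<longleftrightarrow>
            (\<forall>i j. i < j \<and> j < n \<and> S i \<and> S j \<longrightarrow> w ! i \<le> w ! j)" for n
      by (induction n) (auto simp: sorted_wrt_append less_Suc_eq)
    then show ?thesis using S by (auto simp: sorted_map)
  qed
  then show ?thesis unfolding weakly_flattened_def run_leading_terms_def S_def .
qed

text \<open>For the direction from left to right, the last run start \<open>p\<close> is compared with the end of the
  word: no run starts after \<open>p\<close>, so the word climbs weakly from \<open>p\<close> to its last entry \<open>m\<close>, which
  forces \<open>w ! p = m\<close>. The leading terms of earlier runs are at most \<open>w ! p\<close>.\<close>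

lemma weakly_flattened_ending_in_min_iff:
  assumes ne: "w \<noteq> []" and last: "last w = m" and min: "\<And>x. x \<in> set w \<Longrightarrow> m \<le> x"
  shows "weakly_flattened w \<longleftrightarrow> hd w = m \<and> descends_only_to m w"
proof -
  define S where "S i \<longleftrightarrow> i < length w \<and> (i = 0 \<or> w ! i < w ! (i - 1))" for i
  have flat: "weakly_flattened w \<longleftrightarrow> (\<forall>i j. i < j \<and> S i \<and> S j \<longrightarrow> w ! i \<le> w ! j)"
    unfolding weakly_flattened_iff_run_starts run_start_iff S_def by simp
  have target: "hd w = m \<and> descends_only_to m w \<longleftrightarrow> (\<forall>i. S i \<longrightarrow> w ! i = m)"
  proof -
    have "descends_only_to m w \<longleftrightarrow> (\<forall>i. Suc i < length w \<and> w ! Suc i < w ! i \<longrightarrow> w ! Suc i = m)"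
      unfolding descends_only_to_def successively_conv_nth by (meson not_le)
    also have "\<dots> \<longleftrightarrow> (\<forall>i. 0 < i \<and> S i \<longrightarrow> w ! i = m)"
      unfolding S_def by (metis Suc_pred diff_Suc_1 neq0_conv zero_less_Suc)
    finally have "descends_only_to m w \<longleftrightarrow> (\<forall>i. 0 < i \<and> S i \<longrightarrow> w ! i = m)" .
    moreover have "hd w = w ! 0" using ne by (rule hd_conv_nth)
    moreover have "S 0" using ne unfolding S_def by simp
    ultimately show ?thesis by (metis neq0_conv)
  qed
  have "w ! i = m" if f: "weakly_flattened w" and i: "S i" for i
  proof -
    have bnd: "\<And>j. S j \<Longrightarrow> j \<le> length w" unfolding S_def by simp
    define p where "p = (GREATEST j. S j)"
    have p: "S p" unfolding p_def using i bnd by (rule GreatestI_nat)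
    have pmax: "j \<le> p" if "S j" for j
      unfolding p_def using that bnd by (rule Greatest_le_nat)
    have "w ! p \<le> w ! (p + d)" if "p + d < length w" for d
      using that
    proof (induction d)
      case (Suc d)
      have "\<not> S (Suc (p + d))" using pmax[of "Suc (p + d)"] by auto
      then have "w ! (p + d) \<le> w ! Suc (p + d)" using Suc.prems unfolding S_def by auto
      then show ?case using Suc by auto
    qed simp
    from this[of "length w - 1 - p"] have "w ! p \<le> w ! (length w - 1)"
      using p unfolding S_def by auto
    then have "w ! p \<le> m" using last ne by (simp add: last_conv_nth)
    moreover have "w ! i \<le> w ! p"
      using f i p pmax[OF i] unfolding flat by (metis le_neq_implies_less order_refl)
    moreover have "m \<le> w ! i" using i min unfolding S_def by simp
    ultimately show ?thesis by simp
  qed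
  moreover have "weakly_flattened w" if "\<forall>i. S i \<longrightarrow> w ! i = m"
    unfolding flat using that by simp
  ultimately show ?thesis unfolding target by blast
qed

section \<open>Fubini rankings with prescribed reduced content\<close>

text \<open>In a Fubini ranking with reduced content \<open>a\<close>, this is the rank shared by the \<open>a ! i\<close>
  competitors of the \<open>i\<close>-th group of ties, with groups counted from \<open>0\<close>: all members of the earlier
  groups are ahead of them.\<close>

definition block_rank :: "nat list \<Rightarrow> nat \<Rightarrow> nat" where
  "block_rank a i = Suc (sum_list (take i a))"

definition ranking_mset :: "nat list \<Rightarrow> nat multiset" where
  "ranking_mset a = (\<Sum>i<length a. replicate_mset (a ! i) (block_rank a i))"

lemma set_mset_sum_replicate_mset:
  assumes "finite I" "\<And>i. i \<in> I \<Longrightarrow> 1 \<le> c i"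
  shows "set_mset (\<Sum>i\<in>I. replicate_mset (c i) (f i)) = f ` I"
proof -
  have "set_mset (replicate_mset (c i) (f i)) = {f i}" if "i \<in> I" for i
    using assms(2)[OF that] by (simp add: set_mset_replicate_mset_subset)
  then show ?thesis using assms(1) by (auto simp: set_mset_sum)
qed

lemma count_sum_replicate_mset:
  assumes "finite I" "inj_on f I" "i \<in> I"
  shows "count (\<Sum>j\<in>I. replicate_mset (c j) (f j)) (f i) = c i"
proof -
  have "count (\<Sum>j\<in>I. replicate_mset (c j) (f j)) (f i) = (\<Sum>j\<in>I. if j = i then c j else 0)"
    unfolding count_sum using assms by (intro sum.cong) (auto dest: inj_onD)
  then show ?thesis using assms by simp
qed

lemma block_rank_strict_mono:
  assumes pos: "\<forall>x\<in>set a. 1 \<le> x" and "i < j" "j \<le> length a"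
  shows "block_rank a i < block_rank a j"
  using assms(2,3)
proof (induction j)
  case (Suc j)
  have "1 \<le> a ! j" using pos Suc.prems by auto
  then have "block_rank a j < block_rank a (Suc j)"
    using Suc.prems by (simp add: block_rank_def take_Suc_conv_app_nth)
  then show ?case using Suc by (cases "i = j") auto
qed simp

lemma inj_on_block_rank:
  assumes "\<forall>x\<in>set a. 1 \<le> x"
  shows "inj_on (block_rank a) {..<length a}"
  by (rule linorder_inj_onI) (auto dest: block_rank_strict_mono[OF assms])

lemma count_list_eq_count_mset: "count_list r = count (mset r)"
  by (rule ext, induction r) auto

lemma mset_eq_sum_replicate:
  assumes "distinct vs" "set vs = set r"
  shows "mset r = (\<Sum>i<length vs. replicate_mset (count_list r (vs ! i)) (vs ! i))"
proof -
  have "mset r = (\<Sum>x\<in>set r. replicate_mset (count_list r x) x)"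
    by (rule multiset_eqI)
       (simp add: count_sum count_list_eq_count_mset sum.delta not_in_iff[symmetric])
  also have "\<dots> = (\<Sum>i<length vs. replicate_mset (count_list r (vs ! i)) (vs ! i))"
    using assms by (intro sum.reindex_bij_betw[symmetric] bij_betw_nth) auto
  finally show ?thesis .
qed

text \<open>This turns the defining condition of a Fubini ranking into a statement about the increasing list
  \<open>vs\<close> of its distinct values and their multiplicities, from which \<open>block_rank\<close> emerges. It serves both
  directions of the characterisation below.\<close>

lemma card_smaller_entries:
  fixes r vs :: "'a::linorder list"
  assumes vs: "sorted_wrt (<) vs" "set vs = set r" and i: "i < length vs"
  shows "card {j. j < length r \<and> r ! j < vs ! i} = sum_list (take i (map (count_list r) vs))"
proof -
  let ?f = "filter (\<lambda>x. x < vs ! i) r"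
  have less: "vs ! j < vs ! i \<longleftrightarrow> j < i" if "j < length vs" for j
  proof (cases j i rule: linorder_cases)
    case less
    then show ?thesis using sorted_wrt_nth_less[OF vs(1) less i] by simp
  next
    case greater
    then show ?thesis using sorted_wrt_nth_less[OF vs(1) greater that] by simp
  qed simp
  have "set ?f = {x \<in> set vs. x < vs ! i}" using vs(2) by auto
  also have "\<dots> = set (take i vs)"
  proof -
    have "{x \<in> set vs. x < vs ! i} = (!) vs ` {0..<i}"
    proof (intro subset_antisym subsetI)
      fix x assume "x \<in> {x \<in> set vs. x < vs ! i}"
      then obtain j where "j < length vs" "x = vs ! j" "vs ! j < vs ! i"
        by (auto simp: in_set_conv_nth)
      then show "x \<in> (!) vs ` {0..<i}" using less by simp
    next
      fix x assume "x \<in> (!) vs ` {0..<i}"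
      then obtain j where j: "j < i" "x = vs ! j" by auto
      then have "j < length vs" using i by simp
      then show "x \<in> {x \<in> set vs. x < vs ! i}" using j less[of j] by simp
    qed
    then show ?thesis using i by (simp add: nth_image)
  qed
  finally have set: "set ?f = set (take i vs)" .
  have "card {j. j < length r \<and> r ! j < vs ! i} = length ?f"
    by (simp add: length_filter_conv_card)
  also have "\<dots> = (\<Sum>x\<in>set (take i vs). count_list ?f x)"
    by (rule sum_count_set[symmetric]) (use set in auto)
  also have "\<dots> = (\<Sum>x\<in>set (take i vs). count_list r x)"
  proof (rule sum.cong[OF refl])
    fix x assume "x \<in> set (take i vs)"
    then have "x < vs ! i" using set by auto
    then show "count_list ?f x = count_list r x" by (simp add: count_list_eq_count_mset)
  qed
  also have "\<dots> = sum_list (map (count_list r) (take i vs))"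
    using vs(1) by (simp add: sum_list_distinct_conv_sum_set strict_sorted_iff)
  finally show ?thesis by (simp add: take_map)
qed

lemma reduced_content_eq:
  assumes "sorted_wrt (<) vs" "set vs = set r" "set r \<subseteq> {1..length r}"
  shows "reduced_content r = map (count_list r) vs"
proof -
  have "filter (\<lambda>x. count_list r x \<noteq> 0) [1..<Suc (length r)] = vs"
  proof (rule sorted_distinct_set_unique)
    show "set (filter (\<lambda>x. count_list r x \<noteq> 0) [1..<Suc (length r)]) = set vs"
      using assms(2,3) by (auto simp: count_list_0_iff)
  next
    show "sorted (filter (\<lambda>x. count_list r x \<noteq> 0) [1..<Suc (length r)])"
      by (rule sorted_wrt_filter) (rule sorted_upt)
  qed (use assms(1) in \<open>auto simp: strict_sorted_iff\<close>)
  then show ?thesis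
    unfolding reduced_content_def content_def filter_map comp_def by simp
qed

text \<open>From left to right, the ranking condition at an entry equal to the \<open>i\<close>-th smallest value says
  that this value is \<open>1\<close> plus the sum of the preceding multiplicities. From right to left, the
  distinct values are the \<open>block_rank a i\<close>, which increase strictly because the parts of \<open>a\<close> are
  positive, so the same count gives the ranking condition back.\<close>

lemma fubini_ranking_with_reduced_content_iff:
  assumes "composition n a"
  shows "fubini_ranking n r \<and> reduced_content r = a \<longleftrightarrow> mset r = ranking_mset a"
proof
  assume A: "fubini_ranking n r \<and> reduced_content r = a"
  then have len: "length r = n" and sub: "set r \<subseteq> {1..length r}"
    and rk: "\<And>i. i < n \<Longrightarrow> r ! i = 1 + card {j. j < n \<and> r ! j < r ! i}"
    unfolding fubini_ranking_def by auto
  define vs where "vs = sorted_list_of_set (set r)"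
  have vs: "sorted_wrt (<) vs" "set vs = set r" unfolding vs_def by auto
  have a: "a = map (count_list r) vs" using reduced_content_eq[OF vs sub] A by simp
  have "vs ! i = block_rank a i" if i: "i < length vs" for i
  proof -
    obtain p where p: "p < n" "r ! p = vs ! i"
      using vs(2) i len by (metis in_set_conv_nth)
    show ?thesis
      using rk[OF p(1)] card_smaller_entries[OF vs i] len
      unfolding p(2) a block_rank_def by simp
  qed
  then show "mset r = ranking_mset a"
    unfolding ranking_mset_def
    using mset_eq_sum_replicate[of vs r] vs by (simp add: a strict_sorted_iff)
next
  assume M: "mset r = ranking_mset a"
  have pos: "\<forall>x\<in>set a. 1 \<le> x" and sum: "sum_list a = n"
    using assms unfolding composition_def by auto
  have len: "length r = n"
  proof -
    have "length r = size (ranking_mset a)" using M by (metis size_mset)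
    also have "\<dots> = (\<Sum>i<length a. a ! i)" by (simp add: ranking_mset_def size_multiset_sum)
    finally show ?thesis using sum by (simp add: sum_list_sum_nth atLeast0LessThan)
  qed
  define vs where "vs = map (block_rank a) [0..<length a]"
  have srt: "sorted_wrt (<) vs"
    unfolding vs_def sorted_wrt_map
    by (auto simp: sorted_wrt_iff_nth_less intro!: block_rank_strict_mono[OF pos])
  have set: "set vs = set r"
  proof -
    have "set r = set_mset (ranking_mset a)" using M by (metis set_mset_mset)
    also have "\<dots> = block_rank a ` {..<length a}"
      unfolding ranking_mset_def
      by (rule set_mset_sum_replicate_mset) (use pos in auto)
    finally show ?thesis by (auto simp: vs_def)
  qed
  have cnt: "map (count_list r) vs = a"
  proof (rule nth_equalityI)
    fix i assume "i < length (map (count_list r) vs)"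
    then have i: "i < length a" by (simp add: vs_def)
    have "count_list r (block_rank a i) = a ! i"
      unfolding count_list_eq_count_mset M ranking_mset_def
      by (rule count_sum_replicate_mset) (use inj_on_block_rank[OF pos] i in auto)
    then show "map (count_list r) vs ! i = a ! i" using i by (simp add: vs_def)
  qed (simp add: vs_def)
  have rk: "r ! p = 1 + card {j. j < n \<and> r ! j < r ! p}" if p: "p < n" for p
  proof -
    obtain i where i: "i < length vs" "vs ! i = r ! p"
      using set p len by (metis in_set_conv_nth nth_mem)
    then have "r ! p = block_rank a i" by (simp add: vs_def)
    then show ?thesis
      using card_smaller_entries[OF srt set i(1)] len
      unfolding i(2) cnt block_rank_def by simp
  qed
  \<comment> \<open>a competitor is not ahead of itself, so at most \<open>n - 1\<close> others are\<close>
  have sub: "set r \<subseteq> {1..n}"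
  proof
    fix x assume "x \<in> set r"
    then obtain p where p: "p < n" "x = r ! p" using len by (metis in_set_conv_nth)
    have "{j. j < n \<and> r ! j < r ! p} \<subset> {..<n}" using p by auto
    then have "card {j. j < n \<and> r ! j < r ! p} < n"
      using psubset_card_mono[of "{..<n}"] by simp
    then show "x \<in> {1..n}" using rk[OF p(1)] p(2) by simp
  qed
  show "fubini_ranking n r \<and> reduced_content r = a"
    unfolding fubini_ranking_def
  proof (intro conjI allI impI)
    show "reduced_content r = a"
      using reduced_content_eq[OF srt set] sub len cnt by simp
  qed (rule len sub rk | assumption)+
qed

theorem corollary3p7:
  fixes n k :: nat and a :: "nat list"
  assumes "length a = k" and "k \<ge> 1" and "composition n a"
  shows "card {r. fubini_ranking n r \<and> weakly_flattened r \<and> reduced_content r = a \<and> last r = 1}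
       = (\<Prod>i = 2..k. (a ! 0 + a ! (i - 1) - 2) choose (a ! (i - 1)))"
proof -
  have pos: "\<forall>x\<in>set a. 1 \<le> x" using assms(3) by (simp add: composition_def)
  have "1 \<le> a ! 0" using pos assms(1,2) by simp
  then obtain s where s: "a ! 0 = Suc s" by (cases "a ! 0") auto
  \<comment> \<open>the entries other than the ones, with \<open>1 = block_rank a 0\<close>\<close>
  define M where "M = (\<Sum>i\<in>{1..<k}. replicate_mset (a ! i) (block_rank a i))"
  have split: "ranking_mset a = replicate_mset (Suc s) 1 + M"
  proof -
    have "{..<k} = insert 0 {1..<k}" using assms(2) by auto
    then show ?thesis
      unfolding ranking_mset_def M_def assms(1) by (simp add: s block_rank_def)
  qed
  have setM: "set_mset M = block_rank a ` {1..<k}"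
    unfolding M_def by (rule set_mset_sum_replicate_mset) (use pos assms(1) in auto)
  have inj: "inj_on (block_rank a) {1..<k}"
    using inj_on_block_rank[OF pos] by (rule inj_on_subset) (use assms(1) in auto)
  have count: "count M (block_rank a i) = a ! i" if "i \<in> {1..<k}" for i
    unfolding M_def by (rule count_sum_replicate_mset) (use inj that in auto)
  have gt1: "1 < x" if "x \<in># M" for x
    using that setM block_rank_strict_mono[OF pos, of 0] assms(1)
    by (auto simp: block_rank_def)
  have "{r. fubini_ranking n r \<and> weakly_flattened r \<and> reduced_content r = a \<and> last r = 1} =
        {r. mset r = replicate_mset (Suc s) 1 + M \<and> hd r = 1 \<and> last r = 1 \<and> descends_only_to 1 r}"
    (is "?A = ?B")
  proof -
    have "weakly_flattened r \<longleftrightarrow> hd r = 1 \<and> descends_only_to 1 r"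
      if r: "mset r = replicate_mset (Suc s) 1 + M" "last r = 1" for r
    proof (rule weakly_flattened_ending_in_min_iff)
      show "r \<noteq> []" using r(1) by auto
      fix x assume "x \<in> set r"
      then have "x \<in># replicate_mset (Suc s) 1 + M" using r(1) by (metis set_mset_mset)
      then show "1 \<le> x" using gt1[of x] by (auto split: if_splits)
    qed (rule r(2))
    moreover have "fubini_ranking n r \<and> reduced_content r = a \<longleftrightarrow>
        mset r = replicate_mset (Suc s) 1 + M" for r
      unfolding fubini_ranking_with_reduced_content_iff[OF assms(3)] split ..
    ultimately show ?thesis by blast
  qed
  then have "card ?A = (\<Prod>x\<in>set_mset M. (count M x + s - 1) choose count M x)"
    using card_words_descending_only_to_min[OF gt1] by simp
  also have "\<dots> = (\<Prod>i\<in>{1..<k}. (a ! i + s - 1) choose (a ! i))"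
    unfolding setM by (subst prod.reindex[OF inj]) (simp add: count)
  also have "\<dots> = (\<Prod>i = 2..k. (a ! (i - 1) + s - 1) choose (a ! (i - 1)))"
    by (rule prod.reindex_bij_witness[of _ "\<lambda>i. i - 1" Suc]) auto
  also have "\<dots> = (\<Prod>i = 2..k. (a ! 0 + a ! (i - 1) - 2) choose (a ! (i - 1)))"
    by (simp add: s add.commute)
  finally show ?thesis .
qed

end
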